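(* For all positive integers $w$ and $k$ with $\left\lceil \frac{w}{2}\right\rceil \leq k$, there exists a comparability $3$--hypergraph $H$ with clique number $\omega(H)=w$ and chromatic number $\chi(H)\geq k$.
   Context: A $3$--hypergraph $H=(V(H),E(H))$ has a finite vertex set $V(H)$ and edge set $E(H)\subseteq \binom{V(H)}{3}$. The chromatic number $\chi(H)$ is the minimum $k$ such that $V(H)$ can be partitioned into $k$ classes with no edge contained in a single class. The clique number $\omega(H)$ is the largest cardinality of a subset of $V(H)$ all of whose $3$-element subsets are edges. A cyclic ordering of a $3$-element set $\{u,v,w\}$ is one of its two classes of linear orderings up to cyclic rotation, written $(u\,v\,w)=(v\,w\,u)=(w\,u\,v)$. An orientation of $H$ assigns to each edge exactly one of its two cyclic orderings; the set of oriented edges is denoted $O(H)$. An oriented $3$--hypergraph is transitive if whenever $(u\,v\,z)\in O(H)$ and $(z\,v\,w)\in O(H)$, then $(u\,v\,w)\in O(H)$. A (non-oriented) $3$--hypergraph is a comparability $3$--hypergraph if it admits a transitive orientation.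
   Formalization: The cases w = 1, 2 with k ≥ 2 are excluded (for w ≤ 2 it is assumed that k = 1): there the claim is false, since every edge is a clique of size 3, so ω(H) ≤ 2 forces H to have no edges and χ(H) ≤ 1. *)

theory Defs
  imports Complex_Main "HOL-Library.Disjoint_Sets"
begin

definition hypergraph3 :: "'a set \<Rightarrow> 'a set set \<Rightarrow> bool" where
  "hypergraph3 V E \<longleftrightarrow> finite V \<and> E \<subseteq> {e. e \<subseteq> V \<and> card e = 3}"

definition partitionable :: "'a set \<Rightarrow> 'a set set \<Rightarrow> nat \<Rightarrow> bool" where
  "partitionable V E k \<longleftrightarrow>
     (\<exists>P. partition_on V P \<and> card P = k \<and> (\<forall>e\<in>E. \<forall>C\<in>P. \<not> e \<subseteq> C))"

definition chromatic_number :: "'a set \<Rightarrow> 'a set set \<Rightarrow> nat" where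
  "chromatic_number V E = (LEAST k. partitionable V E k)"

definition clique :: "'a set \<Rightarrow> 'a set set \<Rightarrow> 'a set \<Rightarrow> bool" where
  "clique V E S \<longleftrightarrow> S \<subseteq> V \<and> (\<forall>T. T \<subseteq> S \<and> card T = 3 \<longrightarrow> T \<in> E)"

definition clique_number :: "'a set \<Rightarrow> 'a set set \<Rightarrow> nat" where
  "clique_number V E = Max {card S | S. clique V E S}"

text \<open>A linear ordering of a three-element set is a triple; a cyclic ordering is the class of
  such a triple under rotation.\<close>

definition cyc :: "'a \<Rightarrow> 'a \<Rightarrow> 'a \<Rightarrow> ('a \<times> 'a \<times> 'a) set" where
  "cyc u v w = {(u, v, w), (v, w, u), (w, u, v)}"

definition cyclic_orderings :: "'a set \<Rightarrow> ('a \<times> 'a \<times> 'a) set set" where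
  "cyclic_orderings e = {cyc u v w | u v w. distinct [u, v, w] \<and> e = {u, v, w}}"

text \<open>The set of oriented edges, for an assignment of one cyclic ordering to each edge.\<close>

definition orientation :: "'a set set \<Rightarrow> ('a \<times> 'a \<times> 'a) set set \<Rightarrow> bool" where
  "orientation E Or \<longleftrightarrow> (\<exists>f. (\<forall>e\<in>E. f e \<in> cyclic_orderings e) \<and> Or = f ` E)"

definition transitive_orientation :: "'a set set \<Rightarrow> ('a \<times> 'a \<times> 'a) set set \<Rightarrow> bool" where
  "transitive_orientation E Or \<longleftrightarrow> orientation E Or \<and>
     (\<forall>u v z w. cyc u v z \<in> Or \<and> cyc z v w \<in> Or \<longrightarrow> cyc u v w \<in> Or)"

definition comparability_hypergraph3 :: "'a set \<Rightarrow> 'a set set \<Rightarrow> bool" where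
  "comparability_hypergraph3 V E \<longleftrightarrow> hypergraph3 V E \<and> (\<exists>Or. transitive_orientation E Or)"

text \<open>Every edge is a clique of cardinality 3, so a hypergraph of clique number at most 2 has no
  edges and chromatic number at most 1. Hence no hypergraph has clique number 1 or 2 and
  chromatic number at least 2.\<close>

lemma chromatic_number_le_1_if_clique_number_le_2:
  assumes H: "hypergraph3 V E" and w: "clique_number V E \<le> 2"
  shows "chromatic_number V E \<le> 1"
proof -
  have fin: "finite V" using H by (simp add: hypergraph3_def)
  have finC: "finite {card S | S. clique V E S}"
    by (rule finite_subset[of _ "card ` Pow V"]) (use fin in \<open>auto simp: clique_def\<close>)
  have "E = {}"
  proof (rule ccontr)
    assume "E \<noteq> {}"
    then obtain e where e: "e \<in> E" by blast
    then have eV: "e \<subseteq> V" "card e = 3" using H by (auto simp: hypergraph3_def)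
    then have "finite e" using fin finite_subset by blast
    then have "T = e" if "T \<subseteq> e" "card T = 3" for T
      using that eV card_subset_eq by metis
    then have "clique V E e" using e eV by (auto simp: clique_def)
    then have "card e \<le> clique_number V E"
      unfolding clique_number_def using finC by (intro Max_ge) auto
    then show False using eV w by simp
  qed
  show ?thesis
  proof (cases "V = {}")
    case True
    then have "partitionable V E 0"
      using \<open>E = {}\<close> by (auto simp: partitionable_def intro!: exI[of _ "{}"] partition_onI)
    then have "chromatic_number V E \<le> 0" unfolding chromatic_number_def by (rule Least_le)
    then show ?thesis by simp
  next
    case False
    then have "partitionable V E 1"
      using \<open>E = {}\<close> by (auto simp: partitionable_def partition_on_def intro!: exI[of _ "{V}"])
    then show ?thesis unfolding chromatic_number_def by (rule Least_le)
  qed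
qed

end

theory Submission
  imports "HOL-Library.Ramsey" "HOL-Library.Nat_Bijection" Defs
begin

text \<open>The edges of a complete graph, taken as vertices, with the triangles as hyperedges, form a
  linear 3-hypergraph: two triangles share at most one edge. By Ramsey's theorem its chromatic
  number is unbounded. Linearity makes every orientation transitive and forbids cliques on four
  vertices. Adding a disjoint complete 3-hypergraph on \<open>w \<ge> 3\<close> points, oriented cyclically along a
  linear order, yields clique number exactly \<open>w\<close> without lowering the chromatic number.\<close>

section \<open>Linear hypergraphs and the triangle hypergraph\<close>

definition linear_edges :: "'a set set \<Rightarrow> bool" where
  "linear_edges E \<longleftrightarrow> (\<forall>e\<in>E. \<forall>e'\<in>E. \<forall>x y. x \<noteq> y \<and> {x, y} \<subseteq> e \<inter> e' \<longrightarrow> e = e')"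

lemma linear_edgesD:
  "\<lbrakk>linear_edges E; e \<in> E; e' \<in> E; x \<noteq> y; x \<in> e; y \<in> e; x \<in> e'; y \<in> e'\<rbrakk> \<Longrightarrow> e = e'"
  unfolding linear_edges_def by blast

text \<open>Pairs are coded as natural numbers so that the vertices are linearly ordered, as the
  orientation requires, and a complete hypergraph can be placed above all codes.\<close>

definition triangles :: "nat \<Rightarrow> nat set set" where
  "triangles n = (\<lambda>T. set_encode ` nsets T 2) ` nsets {..<n} 3"

section \<open>The cyclic orientation induced by a linear order\<close>

text \<open>The disjuncts are the three rotations of an ascending triple, so the predicate depends
  only on the rotation class.\<close>

definition cyclically_increasing :: "'a::linorder \<Rightarrow> 'a \<Rightarrow> 'a \<Rightarrow> bool" where
  "cyclically_increasing x y z \<longleftrightarrow> x < y \<and> y < z \<or> y < z \<and> z < x \<or> z < x \<and> x < y"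

definition increasing_orientation :: "'a::linorder set set \<Rightarrow> ('a \<times> 'a \<times> 'a) set set" where
  "increasing_orientation E = {cyc x y z | x y z. cyclically_increasing x y z \<and> {x, y, z} \<in> E}"

lemma cyc_in_increasing_orientation_iff:
  "cyc u v w \<in> increasing_orientation E \<longleftrightarrow> cyclically_increasing u v w \<and> {u, v, w} \<in> E"
proof
  assume "cyc u v w \<in> increasing_orientation E"
  then obtain x y z where xyz: "cyc u v w = cyc x y z" "cyclically_increasing x y z" "{x, y, z} \<in> E"
    unfolding increasing_orientation_def by blast
  have "(u, v, w) \<in> cyc u v w" by (simp add: cyc_def)
  then have "(u, v, w) \<in> {(x, y, z), (y, z, x), (z, x, y)}"
    unfolding xyz(1) by (simp add: cyc_def)
  moreover from this have "{u, v, w} = {x, y, z}" by auto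
  ultimately show "cyclically_increasing u v w \<and> {u, v, w} \<in> E"
    using xyz(2,3) by (auto simp: cyclically_increasing_def)
qed (auto simp: increasing_orientation_def)

lemma orientation_increasing_orientation:
  fixes E :: "'a::linorder set set"
  assumes "\<And>e. e \<in> E \<Longrightarrow> card e = 3"
  shows "orientation E (increasing_orientation E)"
proof -
  \<comment> \<open>\<open>f e\<close> gathers all cyclically increasing listings of
    \<open>e\<close>. They form a single rotation class, so no listing has to be chosen.\<close>
  define f :: "'a set \<Rightarrow> ('a \<times> 'a \<times> 'a) set"
    where "f e = {(x, y, z). cyclically_increasing x y z \<and> {x, y, z} = e}" for e
  have f: "f {x, y, z} = cyc x y z" if "cyclically_increasing x y z" for x y z
  proof -
    have "(a, b, c) \<in> cyc x y z"
      if "cyclically_increasing a b c" and abc: "{a, b, c} = {x, y, z}" for a b c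
    proof -
      have "a = x \<or> a = y \<or> a = z" "b = x \<or> b = y \<or> b = z" "c = x \<or> c = y \<or> c = z"
        using abc by blast+
      then show ?thesis
        using that(1) \<open>cyclically_increasing x y z\<close>
        unfolding cyclically_increasing_def cyc_def by (elim disjE) auto
    qed
    moreover have "cyclically_increasing a b c \<and> {a, b, c} = {x, y, z}"
      if "(a, b, c) \<in> cyc x y z" for a b c
    proof -
      from that consider "a = x" "b = y" "c = z" | "a = y" "b = z" "c = x" | "a = z" "b = x" "c = y"
        unfolding cyc_def by blast
      then show ?thesis
        using \<open>cyclically_increasing x y z\<close> unfolding cyclically_increasing_def by cases auto
    qed
    ultimately show ?thesis
      unfolding f_def by fast
  qed
  have ex: "\<exists>x y z. distinct [x, y, z] \<and> cyclically_increasing x y z \<and> e = {x, y, z}"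
    if "e \<in> E" for e
  proof -
    have "e \<in> nsets e 3"
      using assms[OF that] card.infinite[of e] by (auto simp: nsets_def)
    then obtain x y z where "e = {x, y, z}" "x < y" "y < z"
      unfolding ordered_nsets_3_eq by blast
    then show ?thesis
      by (intro exI[of _ x] exI[of _ y] exI[of _ z]) (auto simp: cyclically_increasing_def)
  qed
  have "f e \<in> cyclic_orderings e" if e: "e \<in> E" for e
  proof -
    obtain x y z where "distinct [x, y, z]" "cyclically_increasing x y z" "e = {x, y, z}"
      using ex[OF e] by blast
    then show ?thesis using f[of x y z] unfolding cyclic_orderings_def by blast
  qed
  moreover have "increasing_orientation E = f ` E"
  proof (intro subset_antisym subsetI)
    fix c assume "c \<in> increasing_orientation E"
    then obtain x y z where "c = cyc x y z" "cyclically_increasing x y z" "{x, y, z} \<in> E"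
      unfolding increasing_orientation_def by blast
    then show "c \<in> f ` E" using f[of x y z] by blast
  next
    fix c assume "c \<in> f ` E"
    then obtain e where e: "e \<in> E" "c = f e" by blast
    obtain x y z where "cyclically_increasing x y z" "e = {x, y, z}"
      using ex[OF e(1)] by blast
    then show "c \<in> increasing_orientation E"
      using e f[of x y z] unfolding increasing_orientation_def by blast
  qed
  ultimately show ?thesis
    unfolding orientation_def by blast
qed

text \<open>Read from \<open>v\<close>, the two given cyclic orders are \<open>v, z, u\<close> and
  \<open>v, w, z\<close>. Together they give \<open>v, w, z, u\<close>, so \<open>u, v, w\<close> is
  again cyclically increasing and \<open>u \<noteq> w\<close>. Only the presence of the edge
  remains, which \<open>closed\<close> supplies.\<close>

lemma transitive_increasing_orientation:
  fixes E :: "'a::linorder set set"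
  assumes "\<And>e. e \<in> E \<Longrightarrow> card e = 3"
    and closed: "\<And>u v w z. \<lbrakk>{u, v, z} \<in> E; {z, v, w} \<in> E; u \<noteq> w\<rbrakk> \<Longrightarrow> {u, v, w} \<in> E"
  shows "transitive_orientation E (increasing_orientation E)"
  unfolding transitive_orientation_def cyc_in_increasing_orientation_iff
proof (intro conjI allI impI; (elim conjE)?)
  show "orientation E (increasing_orientation E)"
    by (rule orientation_increasing_orientation) (rule assms)
next
  fix u v z w
  assume c: "cyclically_increasing u v z" "cyclically_increasing z v w"
    and e: "{u, v, z} \<in> E" "{z, v, w} \<in> E"
  show "cyclically_increasing u v w" using c by (auto simp: cyclically_increasing_def)
  have "u \<noteq> w" using c by (auto simp: cyclically_increasing_def)
  then show "{u, v, w} \<in> E" using closed e by blast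
qed

section \<open>Bounding the chromatic number and the clique number\<close>

text \<open>\<open>LEAST\<close> is informative only if some admissible partition exists; the
  partition into singletons is one, since edges have three vertices.\<close>

lemma chromatic_number_geI:
  assumes H: "hypergraph3 V E" and "\<And>m. m < k \<Longrightarrow> \<not> partitionable V E m"
  shows "k \<le> chromatic_number V E"
proof -
  let ?P = "(\<lambda>x. {x}) ` V"
  have "partition_on V ?P" by (auto simp: partition_on_def disjoint_def)
  moreover have "\<not> e \<subseteq> C" if "e \<in> E" "C \<in> ?P" for e C
  proof
    assume "e \<subseteq> C"
    with that(2) have "card e \<le> 1" by (auto simp: subset_singleton_iff)
    with that(1) H show False by (auto simp: hypergraph3_def)
  qed
  ultimately have "partitionable V E (card ?P)" unfolding partitionable_def by blast
  then have "partitionable V E (chromatic_number V E)"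
    unfolding chromatic_number_def by (rule LeastI)
  with assms(2) show ?thesis using not_le by blast
qed

lemma clique_number_eqI:
  assumes "finite V" "clique V E S" "\<And>T. clique V E T \<Longrightarrow> card T \<le> card S"
  shows "clique_number V E = card S"
  unfolding clique_number_def
proof (rule Max_eqI)
  show "finite {card S | S. clique V E S}"
    by (rule finite_subset[of _ "card ` Pow V"]) (use assms(1) in \<open>auto simp: clique_def\<close>)
qed (use assms in auto)

section \<open>The triangle hypergraph: linearity and unbounded chromatic number\<close>

lemma triangles_subset:
  assumes "e \<in> triangles n"
  shows "e \<subseteq> set_encode ` nsets {..<n} 2" "card e = 3"
proof -
  from assms obtain T where T: "T \<in> nsets {..<n} 3" "e = set_encode ` nsets T 2"
    unfolding triangles_def by blast
  then show "e \<subseteq> set_encode ` nsets {..<n} 2"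
    using nsets_mono[of T "{..<n}" 2] by (auto simp: nsets_def)
  have "inj_on set_encode (nsets T 2)"
    by (rule inj_on_subset[OF inj_on_set_encode]) (auto simp: nsets_def)
  then have "card e = card T choose 2" by (simp add: T(2) card_image)
  also have "card T = 3" using T(1) by (simp add: nsets_def)
  finally show "card e = 3" by (simp add: choose_two)
qed

text \<open>This is the source of linearity: two distinct edges of a triangle already determine
  it.\<close>

lemma nsets_2_union_eq:
  assumes "T \<in> nsets A 3" "x \<in> nsets T 2" "y \<in> nsets T 2" "x \<noteq> y"
  shows "x \<union> y = T"
proof (rule card_seteq)
  show "finite T" "x \<union> y \<subseteq> T" using assms by (auto simp: nsets_def)
  have fin: "finite x" "finite y" and card: "card x = 2" "card y = 2"
    using assms by (auto simp: nsets_def)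
  have "\<not> y \<subseteq> x" using card_subset_eq[of x y] fin card assms(4) by auto
  then have "card x < card (x \<union> y)" by (intro psubset_card_mono) (use fin in auto)
  then show "card T \<le> card (x \<union> y)" using assms(1) card by (simp add: nsets_def)
qed

lemma linear_edges_triangles: "linear_edges (triangles n)"
  unfolding linear_edges_def
proof (intro ballI allI impI; elim conjE)
  fix e e' and p q :: nat
  assume "e \<in> triangles n" "e' \<in> triangles n" and pq: "p \<noteq> q" "{p, q} \<subseteq> e \<inter> e'"
  then obtain T T' where T: "T \<in> nsets {..<n} 3" "e = set_encode ` nsets T 2"
    and T': "T' \<in> nsets {..<n} 3" "e' = set_encode ` nsets T' 2"
    unfolding triangles_def by blast
  have decode: "set_decode r \<in> nsets X 2" if "r \<in> set_encode ` nsets X 2" for r X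
    using that by (auto simp: nsets_def)
  have "set_decode p \<noteq> set_decode q" using pq(1) by (metis set_decode_inverse)
  moreover have "p \<in> e" "q \<in> e" "p \<in> e'" "q \<in> e'" using pq(2) by auto
  ultimately have "set_decode p \<union> set_decode q = T" "set_decode p \<union> set_decode q = T'"
    using nsets_2_union_eq[OF T(1) decode decode] nsets_2_union_eq[OF T'(1) decode decode]
    unfolding T(2) T'(2) by blast+
  then show "e = e'" using T(2) T'(2) by simp
qed

text \<open>Quantifying over all larger \<open>V\<close> and \<open>E\<close> makes the bound apply
  directly after further vertices and edges are added.\<close>

lemma triangles_not_partitionable:
  "\<exists>n. \<forall>V E. set_encode ` nsets {..<n} 2 \<subseteq> V \<longrightarrow> triangles n \<subseteq> E \<longrightarrow> finite V
     \<longrightarrow> (\<forall>m<k. \<not> partitionable V E m)"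
proof -
  \<comment> \<open>Every colouring of the pairs below \<open>n\<close> with \<open>k\<close>
    colours has a monochromatic triangle.\<close>
  obtain n :: nat where n: "partn_lst {..<n} (replicate k 3) 2"
    using ramsey_full by blast
  have absurd: False
    if V: "set_encode ` nsets {..<n} 2 \<subseteq> V" "triangles n \<subseteq> E" "finite V" "m < k"
      and "partitionable V E m" for V E m
  proof -
    obtain P where P: "partition_on V P" "card P = m" "\<And>e C. e \<in> E \<Longrightarrow> C \<in> P \<Longrightarrow> \<not> e \<subseteq> C"
      using \<open>partitionable V E m\<close> unfolding partitionable_def by blast
    have "finite P" using P(1) V(3) by (rule finite_elements[rotated])
    then obtain h where h: "bij_betw h P {0..<m}"
      using ex_bij_betw_finite_nat P(2) by blast
    have "\<exists>C. C \<in> P \<and> x \<in> C" if "x \<in> V" for x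
      using P(1) that by (auto simp: partition_on_def)
    then obtain c where c: "\<And>x. x \<in> V \<Longrightarrow> c x \<in> P \<and> x \<in> c x" by metis
    define f where "f = (\<lambda>x. h (c (set_encode x)))"
    have "f \<in> nsets {..<n} 2 \<rightarrow> {..<k}"
    proof
      fix x assume "x \<in> nsets {..<n} 2"
      then have "c (set_encode x) \<in> P" using V(1) c by blast
      then have "f x \<in> {0..<m}" using h unfolding f_def by (auto simp: bij_betw_def)
      then show "f x \<in> {..<k}" using V(4) by simp
    qed
    from partn_lstE[OF n this] obtain i T where iT: "i < k" "T \<in> nsets {..<n} (replicate k 3 ! i)"
      "f ` nsets T 2 \<subseteq> {i}" by auto
    then have T: "T \<in> nsets {..<n} 3" by simp
    let ?e = "set_encode ` nsets T 2"
    have e: "?e \<in> triangles n" unfolding triangles_def using T by blast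
    have sub: "?e \<subseteq> V" using triangles_subset(1)[OF e] V(1) by blast
    have "?e \<noteq> {}" using triangles_subset(2)[OF e] by (metis card.empty zero_neq_numeral)
    then obtain x where x: "x \<in> nsets T 2" by blast
    \<comment> \<open>Since \<open>h\<close> is injective on the classes, equal colours mean equal
      classes: the whole hyperedge \<open>?e\<close> lies in the class of \<open>x\<close>.\<close>
    have "y \<in> c (set_encode x)" if y: "y \<in> ?e" for y
    proof -
      obtain t where t: "t \<in> nsets T 2" "y = set_encode t" using y by blast
      have "f t = f x" using iT(3) t x by auto
      moreover have "y \<in> V" "set_encode x \<in> V" using sub y x by auto
      ultimately have "c y = c (set_encode x)"
        using h c unfolding f_def t(2) bij_betw_def inj_on_def by blast
      then show ?thesis using c[OF \<open>y \<in> V\<close>] by simp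
    qed
    moreover have "c (set_encode x) \<in> P" using c sub x by blast
    ultimately show False using P(3) e V(2) by blast
  qed
  show ?thesis
    by (intro exI allI impI notI) (rule absurd)
qed

section \<open>Disjoint union of a linear and a complete hypergraph\<close>

text \<open>The edges share \<open>v\<close> and \<open>z\<close>, so by disjointness both lie in
  \<open>E\<close> or both in \<open>W\<close>. In \<open>E\<close>, linearity makes them equal,
  contradicting \<open>u \<noteq> w\<close>; in \<open>W\<close>, every triple is an edge.\<close>

lemma pair_closed_linear_union_complete:
  assumes "linear_edges E" "\<And>e. e \<in> E \<Longrightarrow> e \<subseteq> V \<and> card e = 3" "V \<inter> W = {}"
    and e: "{u, v, z} \<in> E \<union> nsets W 3" "{z, v, w} \<in> E \<union> nsets W 3" and "u \<noteq> w"
  shows "{u, v, w} \<in> E \<union> nsets W 3"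
proof -
  have "card {u, v, z} = 3" "card {z, v, w} = 3"
    using e assms(2) by (auto simp: nsets_def)
  then have d: "v \<noteq> z" "u \<noteq> v" "v \<noteq> w" "u \<noteq> z" "w \<noteq> z"
    by (auto simp: card_insert_if split: if_splits)
  show ?thesis
  proof (cases "{u, v, z} \<in> E")
    case True
    then have "v \<notin> W" using assms(2,3) by blast
    then have "{z, v, w} \<in> E" using e(2) by (auto simp: nsets_def)
    with True have "{u, v, z} = {z, v, w}"
      using linear_edgesD[OF assms(1), of _ _ v z] d(1) by blast
    then show ?thesis using d \<open>u \<noteq> w\<close> by blast
  next
    case False
    then have uvz: "{u, v, z} \<subseteq> W" using e(1) by (auto simp: nsets_def)
    then have "{z, v, w} \<notin> E" using assms(2,3) by blast
    then have "w \<in> W" using e(2) by (auto simp: nsets_def)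
    then show ?thesis using uvz d \<open>u \<noteq> w\<close> by (auto simp: nsets_def)
  qed
qed

text \<open>In a clique with at least four vertices, each vertex \<open>x\<close> lies in two
  triples \<open>{a, b, x}\<close> and \<open>{x, a, c}\<close> meeting in two points. Linearity
  keeps both from being in \<open>E\<close>, and disjointness then puts \<open>x\<close> in
  \<open>W\<close>. The 3 in the bound allows for a single edge of \<open>E\<close>.\<close>

lemma clique_linear_union_complete:
  assumes "linear_edges E" "\<And>e. e \<in> E \<Longrightarrow> e \<subseteq> V \<and> card e = 3" "V \<inter> W = {}" "finite W"
    and S: "clique (V \<union> W) (E \<union> nsets W 3) S"
  shows "card S \<le> max 3 (card W)"
proof (cases "card S \<le> 3")
  case False
  \<comment> \<open>An infinite set would have cardinality 0.\<close>
  then have "finite S" using card.infinite by fastforce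
  have "x \<in> W" if "x \<in> S" for x
  proof -
    have "card (S - {x}) \<ge> 3" using False that \<open>finite S\<close> by simp
    then obtain U where U: "U \<subseteq> S - {x}" "card U = 3"
      using obtain_subset_with_card_n by metis
    then obtain a b c where abc: "U = {a, b, c}" "a \<noteq> b" "b \<noteq> c" "a \<noteq> c"
      unfolding card_3_iff by blast
    then have "x \<noteq> a" "x \<noteq> b" "x \<noteq> c" using U(1) by auto
    then have "{a, b, x} \<in> E \<union> nsets W 3" "{x, a, c} \<in> E \<union> nsets W 3"
      using S U(1) abc that unfolding clique_def by auto
    moreover have "{a, b, x} \<notin> E"
    proof
      assume abx: "{a, b, x} \<in> E"
      then have "x \<notin> W" using assms(2,3) by blast
      then have "{x, a, c} \<in> E" using calculation by (auto simp: nsets_def)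
      then have "{a, b, x} = {x, a, c}"
        using linear_edgesD[OF assms(1) abx, of _ a x] \<open>x \<noteq> a\<close> by blast
      then show False using abc \<open>x \<noteq> b\<close> by auto
    qed
    ultimately show "x \<in> W" by (auto simp: nsets_def)
  qed
  then show ?thesis using card_mono[OF assms(4), of S] by (auto simp: le_max_iff_disj)
qed simp

text \<open>The assumption on \<open>w \<le> 2\<close> is forced: by
  \<open>chromatic_number_le_1_if_clique_number_le_2\<close>, clique number 1 or 2 leaves only
  \<open>k = 1\<close>.\<close>

theorem theorem2:
  fixes w k :: nat
  assumes "0 < w" and "0 < k"
    and "\<lceil>real w / 2\<rceil> \<le> int k"
    and "w \<le> 2 \<longrightarrow> k = 1"
  shows "\<exists>(V :: nat set) E. comparability_hypergraph3 V E
           \<and> clique_number V E = w \<and> chromatic_number V E \<ge> k"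
proof (cases "w \<le> 2")
  case True
  \<comment> \<open>With at most two vertices there are no triples, so the whole vertex set is
    vacuously a clique.\<close>
  let ?V = "{..<w}" and ?E = "{} :: nat set set"
  have H: "hypergraph3 ?V ?E" by (simp add: hypergraph3_def)
  have "transitive_orientation ?E (increasing_orientation ?E)"
    by (rule transitive_increasing_orientation) auto
  then have "comparability_hypergraph3 ?V ?E"
    using H by (auto simp: comparability_hypergraph3_def)
  moreover have "clique_number ?V ?E = card {..<w}"
  proof (rule clique_number_eqI)
    have "card T \<noteq> 3" if "T \<subseteq> {..<w}" for T
      using card_mono[OF _ that] True by auto
    then show "clique ?V ?E {..<w}" by (auto simp: clique_def)
    show "card T \<le> card {..<w}" if "clique ?V ?E T" for T
      using that by (intro card_mono) (auto simp: clique_def)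
  qed simp
  moreover have "k \<le> chromatic_number ?V ?E"
  proof (rule chromatic_number_geI[OF H])
    fix m assume "m < k"
    then have "m = 0" using True assms(4) by simp
    \<comment> \<open>Finiteness is what turns \<open>card P = 0\<close> into
      \<open>P = {}\<close>.\<close>
    moreover have "P \<noteq> {}" "finite P" if "partition_on ?V P" for P
      using that assms(1) finite_elements[OF _ that] by (auto simp: partition_on_def)
    ultimately show "\<not> partitionable ?V ?E m"
      unfolding partitionable_def by (metis card_0_eq)
  qed
  ultimately show ?thesis unfolding card_lessThan by blast
next
  case False
  obtain n where n: "\<forall>V E. set_encode ` nsets {..<n} 2 \<subseteq> V \<longrightarrow> triangles n \<subseteq> E \<longrightarrow> finite V
      \<longrightarrow> (\<forall>m<k. \<not> partitionable V E m)"
    using triangles_not_partitionable[of k] by (rule exE)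
  define V where "V = set_encode ` nsets {..<n} 2"
  have finV: "finite V" unfolding V_def by (simp add: finite_imp_finite_nsets)
  then obtain M where M: "\<forall>x\<in>V. x < M" unfolding finite_nat_set_iff_bounded ..
  \<comment> \<open>Starting at the bound \<open>M\<close> keeps \<open>W\<close> disjoint from the
    codes in \<open>V\<close>.\<close>
  define W where "W = {M..<M + w}"
  have W: "finite W" "card W = w" "V \<inter> W = {}" using M by (fastforce simp: W_def)+
  define E where "E = triangles n \<union> nsets W 3"
  have tri: "e \<subseteq> V \<and> card e = 3" if "e \<in> triangles n" for e
    using triangles_subset[OF that] by (simp add: V_def)
  then have card3: "card e = 3" if "e \<in> E" for e using that by (auto simp: E_def nsets_def)
  have H: "hypergraph3 (V \<union> W) E"
    using tri finV W(1) by (auto simp: hypergraph3_def E_def nsets_def)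
  have "transitive_orientation E (increasing_orientation E)"
    using card3 pair_closed_linear_union_complete[OF linear_edges_triangles tri W(3)]
    unfolding E_def by (rule transitive_increasing_orientation)
  then have "comparability_hypergraph3 (V \<union> W) E"
    using H by (auto simp: comparability_hypergraph3_def)
  moreover have "clique_number (V \<union> W) E = card W"
  proof (rule clique_number_eqI)
    show "clique (V \<union> W) E W"
      using W(1) finite_subset by (auto simp: clique_def E_def nsets_def)
    \<comment> \<open>Here \<open>w \<ge> 3\<close> enters: the bound \<open>max 3 (card W)\<close>
      equals \<open>w\<close>.\<close>
    show "card T \<le> card W" if "clique (V \<union> W) E T" for T
      using clique_linear_union_complete[OF linear_edges_triangles tri W(3,1)] that False W(2)
      unfolding E_def by fastforce
  qed (use finV W in auto)
  moreover have "k \<le> chromatic_number (V \<union> W) E"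
    by (rule chromatic_number_geI[OF H], rule n[rule_format]) (use finV W(1) in \<open>auto simp: V_def E_def\<close>)
  ultimately show ?thesis using W(2) by blast
qed

end
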